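(* Let $d\ge 2$. A typical compact set $E\in\mathcal{K}([0,1]^d)$ intersects every $(d-1)$-dimensional plane (affine hyperplane) of $\mathbb{R}^d$ in at most $d$ points; that is, the set of all $E\in\mathcal{K}([0,1]^d)$ for which there is a $(d-1)$-dimensional affine plane $H\subset\mathbb{R}^d$ such that $E\cap H$ has more than $d$ points is of first category in $(\mathcal{K}([0,1]^d),d_H)$.
   Context: $\mathcal{K}([0,1]^d)$ denotes the set of all nonempty compact subsets of $[0,1]^d$ with the Hausdorff metric $d_H(E,F)=\inf\{\varepsilon>0: E\subset F^\varepsilon \text{ and } F\subset E^\varepsilon\}$, where $E^\varepsilon=\{x\in\mathbb{R}^d:\operatorname{dist}(x,E)<\varepsilon\}$. A subset of a metric space is nowhere dense if its closure has empty interior, and is of first category if it is a countable union of nowhere dense sets. A typical element of a metric space $X$ has a property if the set of elements of $X$ not having the property is of first category in $X$. *)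

theory Defs
  imports "HOL-Analysis.Analysis"
begin

section \<open>Hausdorff distance\<close>

definition open_nbhd :: "real \<Rightarrow> 'a::metric_space set \<Rightarrow> 'a set"
  where "open_nbhd e E = {x. infdist x E < e}"

definition hausdist_bounds :: "'a::metric_space set \<Rightarrow> 'a set \<Rightarrow> real set"
  where "hausdist_bounds E F = {e. 0 < e \<and> E \<subseteq> open_nbhd e F \<and> F \<subseteq> open_nbhd e E}"

text \<open>The Hausdorff distance is the infimum of the admissible radii.  The default value 0 is never used for nonempty bounded sets (see
  \<open>hausdist_bounds_nonempty\<close>); it makes the distance nonnegative on all arguments, as
  the locale \<^locale>\<open>Metric_space\<close> demands also outside the carrier.\<close>

definition hausdist :: "'a::metric_space set \<Rightarrow> 'a set \<Rightarrow> real"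
  where "hausdist E F =
    (if hausdist_bounds E F = {} then 0 else Inf (hausdist_bounds E F))"

definition nonempty_compacts :: "'a::metric_space set \<Rightarrow> 'a set set"
  where "nonempty_compacts S = {E. E \<noteq> {} \<and> compact E \<and> E \<subseteq> S}"

definition hyperspace :: "'a::metric_space set \<Rightarrow> 'a set metric"
  where "hyperspace S = metric (nonempty_compacts S, hausdist)"

lemma hausdist_bounds_nonempty:
  assumes "E \<noteq> {}" "F \<noteq> {}" "bounded E" "bounded F"
  shows "hausdist_bounds E F \<noteq> {}"
proof -
  obtain a b where a: "a \<in> E" and b: "b \<in> F" using assms by blast
  obtain r where r: "\<And>x. x \<in> E \<union> F \<Longrightarrow> dist a x \<le> r"
    using assms bounded_Un[of E F] bounded_any_center[of "E \<union> F" a] by blast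
  obtain s where s: "\<And>x. x \<in> E \<union> F \<Longrightarrow> dist b x \<le> s"
    using assms bounded_Un[of E F] bounded_any_center[of "E \<union> F" b] by blast
  define e where "e = max r s + 1"
  have "infdist x F < e" if "x \<in> E" for x
    using infdist_le[OF b, of x] s[of x] that by (simp add: e_def dist_commute)
  moreover have "infdist x E < e" if "x \<in> F" for x
    using infdist_le[OF a, of x] r[of x] that by (simp add: e_def dist_commute)
  moreover have "0 < e"
    using r[of a] a by (simp add: e_def)
  ultimately have "e \<in> hausdist_bounds E F"
    by (auto simp: hausdist_bounds_def open_nbhd_def)
  then show ?thesis by blast
qed

lemma hausdist_bounds_bdd_below: "bdd_below (hausdist_bounds E F)"
  by (rule bdd_belowI[of _ 0]) (auto simp: hausdist_bounds_def)

lemma hausdist_bounds_commute: "hausdist_bounds E F = hausdist_bounds F E"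
  by (auto simp: hausdist_bounds_def)

lemma hausdist_eq_Inf:
  assumes "E \<noteq> {}" "F \<noteq> {}" "bounded E" "bounded F"
  shows "hausdist E F = Inf {e. 0 < e \<and> E \<subseteq> open_nbhd e F \<and> F \<subseteq> open_nbhd e E}"
  using hausdist_bounds_nonempty[OF assms]
  unfolding hausdist_def by (simp only: if_False) (simp only: hausdist_bounds_def)

lemma hausdist_nonneg: "0 \<le> hausdist E F"
  by (auto simp: hausdist_def hausdist_bounds_def intro!: cInf_greatest)

lemma hausdist_commute: "hausdist E F = hausdist F E"
  by (simp add: hausdist_def hausdist_bounds_commute)

lemma hausdist_le: "e \<in> hausdist_bounds E F \<Longrightarrow> hausdist E F \<le> e"
  by (auto simp: hausdist_def intro: cInf_lower hausdist_bounds_bdd_below)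

lemma hausdist_approx:
  assumes "hausdist_bounds E F \<noteq> {}" "hausdist E F < e"
  obtains e' where "e' \<in> hausdist_bounds E F" "e' < e"
  using assms cInf_less_iff[OF assms(1) hausdist_bounds_bdd_below, of e]
  by (auto simp: hausdist_def)

lemma infdist_less_trans:
  assumes "F \<noteq> {}" "infdist x F < e" "F \<subseteq> open_nbhd e' G"
  shows "infdist x G < e + e'"
proof -
  obtain y where "y \<in> F" "dist x y < e"
    using assms cInf_less_iff[of "dist x ` F" e]
    by (auto simp: infdist_notempty intro: bdd_belowI[of _ 0])
  then show ?thesis
    using infdist_triangle[of x G y] assms(3) by (force simp: open_nbhd_def)
qed

lemma hausdist_bounds_add:
  assumes "F \<noteq> {}" "e \<in> hausdist_bounds E F" "e' \<in> hausdist_bounds F G"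
  shows "e + e' \<in> hausdist_bounds E G"
proof -
  have "infdist x G < e + e'" if "x \<in> E" for x
    using assms that infdist_less_trans[of F x e e' G]
    by (simp add: hausdist_bounds_def open_nbhd_def subset_iff)
  moreover have "infdist x E < e + e'" if "x \<in> G" for x
    using assms that infdist_less_trans[of F x e' e E]
    by (simp add: hausdist_bounds_def open_nbhd_def subset_iff)
  moreover have "0 < e + e'"
    using assms by (simp add: hausdist_bounds_def)
  ultimately show ?thesis
    by (simp add: hausdist_bounds_def open_nbhd_def subset_iff)
qed

lemma hausdist_zero_subset:
  assumes "hausdist_bounds E F \<noteq> {}" "hausdist E F = 0" "closed F" "F \<noteq> {}"
  shows "E \<subseteq> F"
proof
  fix x assume x: "x \<in> E"
  have "infdist x F < e" if "0 < e" for e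
  proof -
    obtain e' where "e' \<in> hausdist_bounds E F" "e' < e"
      using hausdist_approx[OF assms(1), of e] assms(2) \<open>0 < e\<close> by metis
    then show ?thesis using x by (force simp: hausdist_bounds_def open_nbhd_def)
  qed
  then have "\<not> 0 < infdist x F"
    by (metis less_irrefl)
  then have "infdist x F = 0"
    using infdist_nonneg[of x F] by linarith
  then show "x \<in> F"
    using assms(3,4) in_closed_iff_infdist_zero by blast
qed

lemma Metric_space_hausdist: "Metric_space (nonempty_compacts S) hausdist"
proof
  show "0 \<le> hausdist E F" for E F :: "'a set" by (rule hausdist_nonneg)
  show "hausdist E F = hausdist F E" for E F :: "'a set" by (rule hausdist_commute)
next
  fix E F assume "E \<in> nonempty_compacts S" "F \<in> nonempty_compacts S"
  then have *: "E \<noteq> {}" "F \<noteq> {}" "closed E" "closed F"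
      and ne: "hausdist_bounds E F \<noteq> {}"
    by (auto simp: nonempty_compacts_def compact_imp_closed compact_imp_bounded
        hausdist_bounds_nonempty)
  show "hausdist E F = 0 \<longleftrightarrow> E = F"
  proof
    assume "hausdist E F = 0"
    then show "E = F"
      using hausdist_zero_subset[of E F] hausdist_zero_subset[of F E] * ne
      by (simp add: hausdist_commute hausdist_bounds_commute subset_antisym)
  next
    assume "E = F"
    then have "e \<in> hausdist_bounds E F" if "0 < e" for e
      using that by (auto simp: hausdist_bounds_def open_nbhd_def)
    then have "hausdist E F \<le> e" if "0 < e" for e
      using that hausdist_le by blast
    then show "hausdist E F = 0"
      using hausdist_nonneg[of E F] field_le_epsilon[of "hausdist E F" 0] by simp
  qed
next
  fix E F G
  assume "E \<in> nonempty_compacts S" "F \<in> nonempty_compacts S" "G \<in> nonempty_compacts S"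
  then have F: "F \<noteq> {}" and ne: "hausdist_bounds E F \<noteq> {}" "hausdist_bounds F G \<noteq> {}"
    by (auto simp: nonempty_compacts_def compact_imp_bounded hausdist_bounds_nonempty)
  show "hausdist E G \<le> hausdist E F + hausdist F G"
  proof (rule field_le_epsilon)
    fix e :: real assume "0 < e"
    obtain u where u: "u \<in> hausdist_bounds E F" "u < hausdist E F + e/2"
      by (rule hausdist_approx[OF ne(1), of "hausdist E F + e/2"]) (use \<open>0 < e\<close> in auto)
    obtain v where v: "v \<in> hausdist_bounds F G" "v < hausdist F G + e/2"
      by (rule hausdist_approx[OF ne(2), of "hausdist F G + e/2"]) (use \<open>0 < e\<close> in auto)
    have "hausdist E G \<le> u + v"
      using hausdist_bounds_add[OF F u(1) v(1)] by (rule hausdist_le)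
    then show "hausdist E G \<le> hausdist E F + hausdist F G + e"
      using u v by linarith
  qed
qed

lemma mspace_hyperspace [simp]: "mspace (hyperspace S) = nonempty_compacts S"
  by (simp add: hyperspace_def Metric_space.mspace_metric[OF Metric_space_hausdist])

lemma mdist_hyperspace [simp]: "mdist (hyperspace S) = hausdist"
  by (simp add: hyperspace_def Metric_space.mdist_metric[OF Metric_space_hausdist])


section \<open>Baire category in a metric space\<close>

definition nowhere_dense_in :: "'a metric \<Rightarrow> 'a set \<Rightarrow> bool"
  where "nowhere_dense_in m A \<longleftrightarrow>
    A \<subseteq> mspace m \<and> mtopology_of m interior_of (mtopology_of m closure_of A) = {}"

definition first_category_in :: "'a metric \<Rightarrow> 'a set \<Rightarrow> bool"
  where "first_category_in m A \<longleftrightarrow>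
    (\<exists>\<N>. countable \<N> \<and> (\<forall>N\<in>\<N>. nowhere_dense_in m N) \<and> A = \<Union>\<N>)"

definition typical_in :: "'a metric \<Rightarrow> ('a \<Rightarrow> bool) \<Rightarrow> bool"
  where "typical_in m P \<longleftrightarrow> first_category_in m {x \<in> mspace m. \<not> P x}"


section \<open>The unit cube and its hyperplane sections\<close>

definition unit_cube :: "(real ^ 'n) set"
  where "unit_cube = {x. \<forall>i. 0 \<le> x $ i \<and> x $ i \<le> 1}"

definition affine_plane :: "nat \<Rightarrow> 'a::euclidean_space set \<Rightarrow> bool"
  where "affine_plane k H \<longleftrightarrow> affine H \<and> aff_dim H = int k"

text \<open>Finiteness is required explicitly because \<^const>\<open>card\<close> is 0 on infinite sets.\<close>

definition at_most_points :: "nat \<Rightarrow> 'a set \<Rightarrow> bool"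
  where "at_most_points k A \<longleftrightarrow> finite A \<and> card A \<le> k"

end

theory Submission
  imports Defs
begin

text \<open>A compact set is bad iff, for some \<open>m\<close>, it contains \<open>d + 1\<close> points of a common hyperplane
  with mutual distances at least \<open>1/(m + 1)\<close>; it suffices that for each \<open>m\<close> these sets are nowhere
  dense.  Finite sets in general position are dense in the hyperspace: perturb a finite net
  point by point, avoiding the finitely many affine hulls of at most \<open>d\<close> earlier points.
  If \<open>F\<close> is such a set and \<open>G\<close> is very close to \<open>F\<close>, then \<open>d + 1\<close> separated points of \<open>G\<close> are
  close to \<open>d + 1\<close> distinct points of \<open>F\<close>; these are affinely independent, and points near
  affinely independent ones do not lie on a hyperplane.\<close>

text \<open>More than \<open>Suc DIM('a)\<close> points are always affinely dependent, so
  independence can be required only up to that size.\<close>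

definition general_position :: "'a::euclidean_space set \<Rightarrow> bool"
  where "general_position F \<longleftrightarrow>
    finite F \<and> (\<forall>T\<subseteq>F. card T \<le> Suc DIM('a) \<longrightarrow> \<not> affine_dependent T)"

text \<open>The separation \<open>r\<close> keeps the points of \<open>T\<close> from merging:
  without it, sets arbitrarily close to a finite one could contain \<open>Suc DIM('a)\<close>
  coplanar points clustered near a single point.\<close>

definition separated_coplanar :: "real \<Rightarrow> 'a::euclidean_space set \<Rightarrow> bool"
  where "separated_coplanar r E \<longleftrightarrow>
    (\<exists>a b T. a \<noteq> 0 \<and> T \<subseteq> E \<inter> {x. a \<bullet> x = b} \<and> card T = Suc DIM('a) \<and>
      pairwise (\<lambda>x y. r \<le> dist x y) T)"

section \<open>Perturbing finite sets into general position\<close>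

lemma general_position_insert:
  fixes F :: "'a::euclidean_space set"
  assumes "general_position F"
    and "\<And>T. T \<subseteq> F \<Longrightarrow> card T \<le> DIM('a) \<Longrightarrow> y \<notin> affine hull T"
  shows "general_position (insert y F)"
  unfolding general_position_def
proof (intro conjI allI impI)
  show fin: "finite (insert y F)"
    using assms(1) by (simp add: general_position_def)
  fix T assume T: "T \<subseteq> insert y F" "card T \<le> Suc DIM('a)"
  show "\<not> affine_dependent T"
  proof (cases "y \<in> T")
    case False
    then show ?thesis
      using T assms(1) by (auto simp: general_position_def)
  next
    case True
    have "finite T"
      using T fin finite_subset by blast
    \<comment> \<open>Removing \<open>y\<close> from \<open>T\<close> leaves at most
      \<open>DIM('a)\<close> points of \<open>F\<close>, the size at which the hypothesis on
      \<open>y\<close> applies.\<close>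
    then have c: "card (T - {y}) \<le> DIM('a)"
      using True T(2) by simp
    moreover have s: "T - {y} \<subseteq> F"
      using T by auto
    ultimately have "\<not> affine_dependent (T - {y})" "y \<notin> affine hull (T - {y})"
      using assms by (auto simp: general_position_def)
    then have "\<not> affine_dependent (insert y (T - {y}))"
      by (metis affine_independent_insert)
    then show ?thesis
      using True by (simp add: insert_absorb)
  qed
qed

text \<open>The affine hull of at most \<open>DIM('a)\<close> points has empty interior and, being
  convex, is negligible. Finitely many such hulls cannot cover a nonempty open set.\<close>

lemma open_avoids_affine_hulls:
  fixes U :: "'a::euclidean_space set"
  assumes "finite F" "open U" "U \<noteq> {}"
  obtains y where "y \<in> U" "\<And>T. T \<subseteq> F \<Longrightarrow> card T \<le> DIM('a) \<Longrightarrow> y \<notin> affine hull T"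
proof -
  define \<H> where "\<H> = {affine hull T |T. T \<subseteq> F \<and> card T \<le> DIM('a)}"
  have "\<H> \<subseteq> (\<lambda>T. affine hull T) ` Pow F"
    by (auto simp: \<H>_def)
  then have "finite \<H>"
    using assms(1) finite_surj by blast
  moreover have "negligible S" if S: "S \<in> \<H>" for S
  proof -
    obtain T where T: "S = affine hull T" "T \<subseteq> F" "card T \<le> DIM('a)"
      using S by (auto simp: \<H>_def)
    then have "interior S = {}"
      using empty_interior_affine_hull[of T] finite_subset[OF _ assms(1)] by auto
    then show ?thesis
      using T by (simp add: negligible_convex_interior affine_imp_convex)
  qed
  ultimately have "negligible (\<Union>\<H>)"
    by (rule negligible_Union)
  then have "\<not> U \<subseteq> \<Union>\<H>"
    using assms(2,3) negligible_subset open_not_negligible by blast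
  then obtain y where "y \<in> U" "y \<notin> \<Union>\<H>"
    by blast
  then show thesis
    by (intro that[of y]) (auto simp: \<H>_def)
qed

text \<open>Induction on \<open>X\<close>: the earlier points of \<open>F\<close> stay fixed and one
  point near the new \<open>x\<close> is added. The closure hypothesis leaves an open set of
  candidates inside \<open>S\<close> even when \<open>x\<close> lies on the boundary of
  \<open>S\<close>.\<close>

lemma general_position_perturbation:
  fixes X S :: "'a::euclidean_space set"
  assumes "finite X" "0 < e" "X \<subseteq> closure (interior S)"
  shows "\<exists>F. general_position F \<and> F \<subseteq> S \<and>
    (\<forall>x\<in>X. \<exists>y\<in>F. dist x y < e) \<and> (\<forall>y\<in>F. \<exists>x\<in>X. dist x y < e)"
  using assms(1,3)
proof (induction X rule: finite_induct)
  case empty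
  then show ?case
    by (auto simp: general_position_def intro!: exI[of _ "{}"])
next
  case (insert x X)
  then obtain F where F: "general_position F" "F \<subseteq> S"
      "\<forall>x\<in>X. \<exists>y\<in>F. dist x y < e" "\<forall>y\<in>F. \<exists>x\<in>X. dist x y < e"
    by auto
  have "x \<in> closure (interior S)"
    using insert.prems by simp
  then obtain z where "z \<in> interior S" "dist z x < e"
    using \<open>0 < e\<close> closure_approachable by blast
  then have "ball x e \<inter> interior S \<noteq> {}"
    by (auto simp: dist_commute)
  moreover have "finite F" "open (ball x e \<inter> interior S)"
    using F(1) by (auto simp: general_position_def)
  ultimately obtain y where y: "y \<in> ball x e \<inter> interior S"
      "\<And>T. T \<subseteq> F \<Longrightarrow> card T \<le> DIM('a) \<Longrightarrow> y \<notin> affine hull T"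
    using open_avoids_affine_hulls by metis
  have "general_position (insert y F)"
    using F(1) y(2) by (rule general_position_insert)
  moreover have "y \<in> S" "dist x y < e"
    using y(1) interior_subset by auto
  ultimately show ?case
    using F by (intro exI[of _ "insert y F"]) auto
qed

section \<open>Density in the Hausdorff metric\<close>

lemma hausdist_le_pointwise:
  assumes "0 < e" "E \<noteq> {}" "F \<noteq> {}"
    and "\<And>x. x \<in> E \<Longrightarrow> \<exists>y\<in>F. dist x y < e" "\<And>y. y \<in> F \<Longrightarrow> \<exists>x\<in>E. dist x y < e"
  shows "hausdist E F \<le> e"
proof (rule hausdist_le)
  have "infdist x F < e" if "x \<in> E" for x
    using assms(4)[OF that] infdist_le le_less_trans by blast
  moreover have "infdist y E < e" if "y \<in> F" for y
    using assms(5)[OF that] infdist_le[of _ E y] by (metis dist_commute le_less_trans)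
  ultimately show "e \<in> hausdist_bounds E F"
    using assms(1) by (auto simp: hausdist_bounds_def open_nbhd_def)
qed

lemma hausdist_less_obtain:
  assumes "E \<in> nonempty_compacts S" "F \<in> nonempty_compacts S" "hausdist E F < e" "y \<in> F"
  obtains x where "x \<in> E" "dist x y < e"
proof -
  have "hausdist_bounds E F \<noteq> {}"
    using assms by (intro hausdist_bounds_nonempty)
      (auto simp: nonempty_compacts_def compact_imp_bounded)
  then obtain e' where "e' \<in> hausdist_bounds E F" "e' < e"
    using assms(3) hausdist_approx by blast
  then have "infdist y E < e"
    using assms(4) by (force simp: hausdist_bounds_def open_nbhd_def)
  moreover have "E \<noteq> {}"
    using assms(1) by (auto simp: nonempty_compacts_def)
  ultimately obtain x where "x \<in> E" "dist y x < e"
    using cInf_less_iff[of "dist y ` E" e] by (auto simp: infdist_notempty intro: bdd_belowI[of _ 0])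
  then show thesis
    using that by (simp add: dist_commute)
qed

lemma general_position_dense:
  fixes S :: "'a::euclidean_space set"
  assumes "S \<subseteq> closure (interior S)" "E \<in> nonempty_compacts S" "0 < e"
  obtains F where "F \<in> nonempty_compacts S" "general_position F" "hausdist E F < e"
proof -
  \<comment> \<open>A net of radius \<open>r\<close> moved by less than \<open>r\<close> gives
    distance at most \<open>2 * r\<close>, which is \<open>e / 2\<close> and hence strictly below
    \<open>e\<close>.\<close>
  define r where "r = e / 4"
  have r: "0 < r"
    using assms(3) by (simp add: r_def)
  obtain X where X: "finite X" "X \<subseteq> E" "E \<subseteq> (\<Union>x\<in>X. ball x r)"
  proof (rule compactE_image[of E E "\<lambda>x. ball x r"])
    show "compact E"
      using assms(2) by (simp add: nonempty_compacts_def)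
    show "E \<subseteq> (\<Union>x\<in>E. ball x r)"
      using r by auto
  qed auto
  have E: "E \<noteq> {}" "E \<subseteq> S"
    using assms(2) by (auto simp: nonempty_compacts_def)
  then have "X \<subseteq> closure (interior S)"
    using X(2) assms(1) by blast
  from general_position_perturbation[OF X(1) r this]
  obtain F where F: "general_position F" "F \<subseteq> S"
      "\<forall>x\<in>X. \<exists>y\<in>F. dist x y < r" "\<forall>y\<in>F. \<exists>x\<in>X. dist x y < r"
    by blast
  have near: "\<exists>y\<in>F. dist x y < 2 * r" if x: "x \<in> E" for x
  proof -
    obtain z where "z \<in> X" "dist z x < r"
      using X(3) x by auto
    moreover then obtain y where "y \<in> F" "dist z y < r"
      using F(3) by blast
    ultimately show ?thesis
      using dist_triangle[of x y z] by (force simp: dist_commute)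
  qed
  then have "F \<noteq> {}"
    using E(1) by blast
  moreover have "\<exists>x\<in>E. dist x y < 2 * r" if "y \<in> F" for y
    using F(4) that X(2) r by (smt (verit) subsetD)
  ultimately have "hausdist E F \<le> 2 * r"
    using near E(1) r by (intro hausdist_le_pointwise) auto
  moreover have "F \<in> nonempty_compacts S"
    using F \<open>F \<noteq> {}\<close> by (simp add: nonempty_compacts_def general_position_def finite_imp_compact)
  ultimately show thesis
    using that F(1) assms(3) by (simp add: r_def)
qed

section \<open>Stability of general position\<close>

lemma affine_independent_not_coplanar:
  fixes T :: "'a::euclidean_space set"
  assumes "\<not> affine_dependent T" "card T = Suc DIM('a)" "a \<noteq> 0"
  shows "\<not> T \<subseteq> {x. a \<bullet> x = b}"
proof
  assume "T \<subseteq> {x. a \<bullet> x = b}"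
  then have "aff_dim T \<le> aff_dim {x. a \<bullet> x = b}"
    by (rule aff_dim_subset)
  moreover have "aff_dim {x. a \<bullet> x = b} = int DIM('a) - 1"
    using assms(3) by (simp add: of_nat_diff Suc_leI)
  moreover have "aff_dim T = int DIM('a)"
    using aff_dim_affine_independent[OF assms(1)] assms(2) by simp
  ultimately show False
    by linarith
qed

text \<open>Compactness of the unit sphere: the total deviation of \<open>T\<close> from lying in a
  plane with unit normal \<open>a\<close> has a positive minimum over all \<open>a\<close>, and a
  small perturbation cannot bring it to zero.\<close>

lemma affine_independent_stable:
  fixes T :: "'a::euclidean_space set"
  assumes "\<not> affine_dependent T" "card T = Suc DIM('a)"
  shows "\<exists>\<delta>>0. \<forall>a b f. a \<noteq> 0 \<longrightarrow> (\<forall>y\<in>T. dist y (f y) < \<delta>) \<longrightarrow> \<not> (\<forall>y\<in>T. a \<bullet> f y = b)"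
proof -
  \<comment> \<open>Infinite sets have \<open>card\<close> 0, which is not a successor.\<close>
  have fin: "finite T"
    using assms(2) by (metis card.infinite nat.distinct(1))
  obtain y0 where y0: "y0 \<in> T"
    using assms(2) by fastforce
  \<comment> \<open>\<open>g a\<close> vanishes exactly when \<open>T\<close> lies in the plane with
    normal \<open>a\<close> through \<open>y0\<close>.\<close>
  define g where "g a = (\<Sum>y\<in>T. \<bar>a \<bullet> (y - y0)\<bar>)" for a
  have "continuous_on (sphere 0 1) g"
    unfolding g_def by (intro continuous_intros)
  then obtain a0 where a0: "a0 \<in> sphere 0 1" "\<And>a. a \<in> sphere 0 1 \<Longrightarrow> g a0 \<le> g a"
    using continuous_attains_inf[of "sphere (0::'a) 1" g] by auto
  have "a0 \<noteq> 0"
    using a0(1) by auto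
  have "g a0 \<noteq> 0"
  proof
    assume "g a0 = 0"
    then have "\<forall>y\<in>T. a0 \<bullet> y = a0 \<bullet> y0"
      using fin by (simp add: g_def sum_nonneg_eq_0_iff inner_diff_right)
    then show False
      using affine_independent_not_coplanar[OF assms \<open>a0 \<noteq> 0\<close>] by blast
  qed
  moreover have "0 \<le> g a0"
    by (simp add: g_def sum_nonneg)
  ultimately have pos: "0 < g a0"
    by simp
  \<comment> \<open>Chosen so that \<open>card T\<close> summands of size
    \<open>2 * \<delta>\<close> add up to the minimum \<open>g a0\<close>.\<close>
  define \<delta> where "\<delta> = g a0 / (2 * card T)"
  have "0 < \<delta>"
    using pos assms(2) by (simp add: \<delta>_def)
  moreover have False
    if a: "a \<noteq> 0" and near: "\<forall>y\<in>T. dist y (f y) < \<delta>" and plane: "\<forall>y\<in>T. a \<bullet> f y = b" for a b f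
  proof -
    \<comment> \<open>The minimum of \<open>g\<close> is taken over unit normals, so
      \<open>a\<close> is rescaled.\<close>
    define u where "u = sgn a"
    have u: "norm u = 1"
      using a by (simp add: u_def norm_sgn)
    have uf: "u \<bullet> f y = u \<bullet> f y0" if "y \<in> T" for y
      using plane that y0 by (simp add: u_def sgn_div_norm)
    have small: "\<bar>u \<bullet> (y - f y)\<bar> < \<delta>" if "y \<in> T" for y
      using Cauchy_Schwarz_ineq2[of u "y - f y"] near that u by (fastforce simp: dist_norm)
    \<comment> \<open>\<open>f y\<close> and \<open>f y0\<close> have the same component along
      \<open>u\<close>, so those of \<open>y\<close> and \<open>y0\<close> differ only by two
      displacements, each below \<delta>.\<close>
    have "\<bar>u \<bullet> (y - y0)\<bar> < 2 * \<delta>" if "y \<in> T" for y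
      using small[OF that] small[OF y0] uf[OF that] by (simp add: inner_diff_right)
    then have "g u < (\<Sum>y\<in>T. 2 * \<delta>)"
      unfolding g_def using fin y0 by (intro sum_strict_mono) auto
    also have "\<dots> = g a0"
      using assms(2) by (simp add: \<delta>_def field_simps)
    finally show False
      using a0(2)[of u] u by simp
  qed
  ultimately show ?thesis
    by blast
qed

lemma general_position_stable:
  fixes F :: "'a::euclidean_space set"
  assumes F: "general_position F" "F \<in> nonempty_compacts S" and "0 < r"
  obtains \<delta> where "0 < \<delta>"
    "\<And>G. G \<in> nonempty_compacts S \<Longrightarrow> hausdist F G < \<delta> \<Longrightarrow> \<not> separated_coplanar r G"
proof -
  define \<T> where "\<T> = {T. T \<subseteq> F \<and> card T = Suc DIM('a)}"
  have "\<forall>T\<in>\<T>. \<exists>\<delta>>0. \<forall>a b f. a \<noteq> 0 \<longrightarrow> (\<forall>y\<in>T. dist y (f y) < \<delta>) \<longrightarrow> \<not> (\<forall>y\<in>T. a \<bullet> f y = b)"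
    using F(1) by (intro ballI affine_independent_stable) (auto simp: \<T>_def general_position_def)
  then obtain D where D: "\<forall>T\<in>\<T>. 0 < D T \<and>
      (\<forall>a b f. a \<noteq> 0 \<longrightarrow> (\<forall>y\<in>T. dist y (f y) < D T) \<longrightarrow> \<not> (\<forall>y\<in>T. a \<bullet> f y = b))"
    by metis
  have "finite \<T>"
    using F(1) by (simp add: \<T>_def general_position_def)
  \<comment> \<open>The bound \<open>r / 2\<close> makes the passage from separated points of
    \<open>G\<close> to nearby points of \<open>F\<close> injective. It also keeps the minimum
    meaningful when \<open>F\<close> has too few points and \<open>\<T>\<close> is empty.\<close>
  define \<delta> where "\<delta> = Min (insert (r / 2) (D ` \<T>))"
  have "0 < \<delta>"
    using D \<open>finite \<T>\<close> \<open>0 < r\<close> by (simp add: \<delta>_def)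
  have \<delta>_le: "\<delta> \<le> D T" if "T \<in> \<T>" for T
    using that \<open>finite \<T>\<close> by (simp add: \<delta>_def)
  have \<delta>_r: "\<delta> \<le> r / 2"
    unfolding \<delta>_def using \<open>finite \<T>\<close> by (intro Min_le) auto
  have "\<not> separated_coplanar r G" if G: "G \<in> nonempty_compacts S" "hausdist F G < \<delta>" for G
  proof
    assume "separated_coplanar r G"
    then obtain a b T where T: "a \<noteq> 0" "T \<subseteq> G \<inter> {x. a \<bullet> x = b}" "card T = Suc DIM('a)"
        "pairwise (\<lambda>x y. r \<le> dist x y) T"
      by (auto simp: separated_coplanar_def)
    have "\<forall>z\<in>T. \<exists>y\<in>F. dist y z < \<delta>"
      using hausdist_less_obtain[OF F(2) G] T(2) by blast
    then obtain h where h: "\<And>z. z \<in> T \<Longrightarrow> h z \<in> F \<and> dist (h z) z < \<delta>"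
      by metis
    have inj: "inj_on h T"
    proof (rule inj_onI, rule ccontr)
      fix z w assume zw: "z \<in> T" "w \<in> T" "h z = h w" "z \<noteq> w"
      then have "r \<le> dist z w"
        using T(4) by (simp add: pairwise_def)
      moreover have "dist z w < 2 * \<delta>"
        using dist_triangle[of z w "h z"] h[OF zw(1)] h[OF zw(2)] zw(3)
        by (simp add: dist_commute)
      ultimately show False
        using \<delta>_r by simp
    qed
    \<comment> \<open>Stability perturbs points of \<open>F\<close>, whereas \<open>h\<close> leads
      from \<open>G\<close> to \<open>F\<close>; hence the inverse.\<close>
    define f where "f = inv_into T h"
    have f: "f (h z) = z" if "z \<in> T" for z
      using inj that by (simp add: f_def)
    have hT: "h ` T \<in> \<T>"
      using h T(3) inj by (auto simp: \<T>_def card_image)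
    have "dist y (f y) < D (h ` T)" if "y \<in> h ` T" for y
      using that h f \<delta>_le[OF hT] by fastforce
    moreover have "a \<bullet> f y = b" if "y \<in> h ` T" for y
      using that f T(2) by auto
    moreover have "\<not> (\<forall>y\<in>h ` T. a \<bullet> f y = b)" if "\<forall>y\<in>h ` T. dist y (f y) < D (h ` T)"
      using bspec[OF D hT] T(1) that by blast
    ultimately show False
      by blast
  qed
  with \<open>0 < \<delta>\<close> show thesis
    using that by blast
qed

section \<open>Category argument\<close>

text \<open>By density, a ball inside the closure would contain a set \<open>F\<close> in general
  position; by stability, a ball around \<open>F\<close> misses the bad sets, so \<open>F\<close> is
  not in their closure.\<close>

lemma nowhere_dense_separated_coplanar:
  fixes S :: "'a::euclidean_space set"
  assumes "S \<subseteq> closure (interior S)" "0 < r"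
  shows "nowhere_dense_in (hyperspace S) {E \<in> nonempty_compacts S. separated_coplanar r E}"
    (is "nowhere_dense_in _ ?N")
proof -
  interpret M: Metric_space "nonempty_compacts S" hausdist
    by (rule Metric_space_hausdist)
  have top: "mtopology_of (hyperspace S) = M.mtopology"
    by (simp add: mtopology_of_def)
  have False if E: "E \<in> M.mtopology interior_of (M.mtopology closure_of ?N)" for E
  proof -
    obtain e where e: "E \<in> nonempty_compacts S" "0 < e" "M.mball E e \<subseteq> M.mtopology closure_of ?N"
      using E unfolding M.metric_interior_of by blast
    obtain F where F: "F \<in> nonempty_compacts S" "general_position F" "hausdist E F < e"
      using general_position_dense[OF assms(1) e(1,2)] .
    then have cl: "F \<in> M.mtopology closure_of ?N"
      using e by (auto simp: M.in_mball)
    obtain \<delta> where \<delta>: "0 < \<delta>"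
        "\<And>G. G \<in> nonempty_compacts S \<Longrightarrow> hausdist F G < \<delta> \<Longrightarrow> \<not> separated_coplanar r G"
      using general_position_stable[OF F(2,1) assms(2)] by blast
    then show False
      using cl unfolding M.metric_closure_of M.in_mball by blast
  qed
  then show ?thesis
    unfolding nowhere_dense_in_def top by auto
qed

lemma finite_pairwise_dist_bound:
  fixes T :: "'a::metric_space set"
  assumes "finite T"
  obtains m :: nat where "pairwise (\<lambda>x y. 1 / Suc m \<le> dist x y) T"
proof -
  define P where "P = (\<lambda>(x, y). dist x y) ` (T \<times> T) - {0}"
  have "finite P"
    using assms by (simp add: P_def)
  moreover have "\<forall>p\<in>P. 0 < p"
    by (auto simp: P_def)
  \<comment> \<open>Inserting 1 covers sets \<open>T\<close> with at most one point, where
    \<open>P\<close> is empty.\<close>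
  ultimately have "0 < Min (insert 1 P)"
    by simp
  then obtain m where m: "1 / Suc m < Min (insert 1 P)"
    by (metis nat_approx_posE)
  have "1 / Suc m \<le> dist x y" if "x \<in> T" "y \<in> T" "x \<noteq> y" for x y
  proof -
    have "dist x y \<in> P"
      using that by (force simp: P_def)
    then show ?thesis
      using m \<open>finite P\<close> by (auto simp: less_imp_le)
  qed
  then show thesis
    by (intro that[of m]) (auto simp: pairwise_def)
qed

lemma affine_plane_iff_hyperplane:
  fixes H :: "'a::euclidean_space set"
  shows "affine_plane (DIM('a) - 1) H \<longleftrightarrow> (\<exists>a b. a \<noteq> 0 \<and> H = {x. a \<bullet> x = b})"
proof
  assume "affine_plane (DIM('a) - 1) H"
  then have "affine hull H = H" "aff_dim H = int (DIM('a)) - 1"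
    \<comment> \<open>The subtraction on naturals is exact because \<open>DIM('a)\<close> is
      positive.\<close>
    by (auto simp: affine_plane_def of_nat_diff Suc_leI)
  moreover from this(2) obtain a b where "a \<noteq> 0" "affine hull H = {x. a \<bullet> x = b}"
    using aff_dim_eq_hyperplane[of H] by auto
  ultimately show "\<exists>a b. a \<noteq> 0 \<and> H = {x. a \<bullet> x = b}"
    by blast
next
  assume "\<exists>a b. a \<noteq> 0 \<and> H = {x. a \<bullet> x = b}"
  then show "affine_plane (DIM('a) - 1) H"
    by (auto simp: affine_plane_def affine_hyperplane of_nat_diff Suc_leI)
qed

lemma not_at_most_points_iff:
  "\<not> at_most_points k A \<longleftrightarrow> (\<exists>T\<subseteq>A. finite T \<and> card T = Suc k)"
proof
  assume "\<not> at_most_points k A"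
  then consider "infinite A" | "Suc k \<le> card A"
    by (force simp: at_most_points_def)
  then show "\<exists>T\<subseteq>A. finite T \<and> card T = Suc k"
    by cases (metis infinite_arbitrarily_large, metis obtain_subset_with_card_n)
next
  assume "\<exists>T\<subseteq>A. finite T \<and> card T = Suc k"
  then show "\<not> at_most_points k A"
    by (metis at_most_points_def card_mono not_less_eq_eq)
qed

text \<open>Finitely many distinct points have a positive least distance, which exceeds some
  \<open>1 / Suc m\<close>. This splits the bad sets into countably many classes.\<close>

lemma coplanar_points_iff_separated:
  fixes E :: "'a::euclidean_space set"
  shows "(\<exists>H. affine_plane (DIM('a) - 1) H \<and> \<not> at_most_points DIM('a) (E \<inter> H)) \<longleftrightarrow>
    (\<exists>m::nat. separated_coplanar (1 / Suc m) E)"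
proof
  assume "\<exists>H. affine_plane (DIM('a) - 1) H \<and> \<not> at_most_points DIM('a) (E \<inter> H)"
  then obtain a b T where "a \<noteq> 0" "T \<subseteq> E \<inter> {x. a \<bullet> x = b}" "finite T" "card T = Suc DIM('a)"
    unfolding affine_plane_iff_hyperplane not_at_most_points_iff by blast
  then show "\<exists>m::nat. separated_coplanar (1 / Suc m) E"
    using finite_pairwise_dist_bound[of T] unfolding separated_coplanar_def by metis
next
  assume "\<exists>m::nat. separated_coplanar (1 / Suc m) E"
  then obtain a b T where "a \<noteq> 0" "T \<subseteq> E \<inter> {x. a \<bullet> x = b}" "card T = Suc DIM('a)"
    unfolding separated_coplanar_def by blast
  moreover then have "finite T"
    by (metis card.infinite nat.distinct(1))
  ultimately show "\<exists>H. affine_plane (DIM('a) - 1) H \<and> \<not> at_most_points DIM('a) (E \<inter> H)"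
    unfolding affine_plane_iff_hyperplane not_at_most_points_iff by blast
qed

lemma unit_cube_subset_closure_interior:
  "(unit_cube :: (real ^ 'n) set) \<subseteq> closure (interior unit_cube)"
proof -
  have cube: "unit_cube = cbox 0 (1 :: real ^ 'n)"
    by (auto simp: unit_cube_def mem_box_cart)
  \<comment> \<open>The centre of the cube shows that the open box is nonempty, so its closure is
    the closed box.\<close>
  have "(1/2) *\<^sub>R (1 :: real ^ 'n) \<in> box 0 1"
    by (simp add: mem_box_cart)
  then have "box 0 (1 :: real ^ 'n) \<noteq> {}"
    by blast
  then show ?thesis
    by (simp add: cube closure_box)
qed

theorem theorem1p2:
  assumes "CARD('n::finite) \<ge> 2"
  shows "typical_in (hyperspace (unit_cube :: (real ^ 'n) set))
    (\<lambda>E. \<forall>H. affine_plane (CARD('n) - 1) H \<longrightarrow> at_most_points CARD('n) (E \<inter> H))"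
proof -
  let ?K = "nonempty_compacts (unit_cube :: (real ^ 'n) set)"
  define N where "N m = {E \<in> ?K. separated_coplanar (1 / Suc m) E}" for m :: nat
  have "{E \<in> ?K. \<not> (\<forall>H. affine_plane (CARD('n) - 1) H \<longrightarrow> at_most_points CARD('n) (E \<inter> H))}
      = \<Union>(range N)"
    using coplanar_points_iff_separated[where 'a = "real ^ 'n"] by (auto simp: N_def)
  moreover have "nowhere_dense_in (hyperspace unit_cube) (N m)" for m
    unfolding N_def
    by (rule nowhere_dense_separated_coplanar[OF unit_cube_subset_closure_interior]) simp
  ultimately show ?thesis
    unfolding typical_in_def first_category_in_def mspace_hyperspace
    by (intro exI[of _ "range N"]) auto
qed

end
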